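(* Let $R$ be a $G$-graded ring, let $M$ be a $G$-graded weakly topological $R$-module and let $P\subseteq\Upsilon_M$ be a subset. Then $\eta(P)$ is a graded pseudo weakly prime submodule of $M$ if and only if $P$ is an irreducible space (with the topology induced from the Zariski topology on $\Upsilon_M$).
   Context: Conventions: $G$ is an abelian group with identity $e$; rings are commutative with identity and modules are unital. A ring $R$ is $G$-graded if $R=\bigoplus_{g\in G}R_g$ with additive subgroups $R_g$ and $R_gR_h\subseteq R_{gh}$; $h(R)=\bigcup_{g}R_g$. An ideal $I$ of $R$ is graded if $I=\bigoplus_g (I\cap R_g)$. An $R$-module $M$ is $G$-graded if $M=\bigoplus_{g}M_g$ with additive subgroups $M_g$ and $R_gM_h\subseteq M_{gh}$. A submodule $P$ of $M$ is graded if $P=\bigoplus_g (P\cap M_g)$. Put $(P:_RM)=\{r\in R: rM\subseteq P\}$. A proper graded ideal $I$ of $R$ is graded weakly prime if whenever $a,b\in h(R)$ and $0\neq ab\in I$, then $a\in I$ or $b\in I$. A graded submodule $P$ of $M$ is graded pseudo weakly prime if $(P:_RM)$ is a graded weakly prime ideal of $R$; $\Upsilon_M$ is the set of all graded pseudo weakly prime submodules of $M$. A graded submodule of $M$ is graded pseudo weakly semiprime if it is an intersection of graded pseudo weakly prime submodules of $M$. A graded pseudo weakly prime submodule $P$ of $M$ is graded weakly extraordinary if whenever $I,J$ are graded pseudo weakly semiprime submodules of $M$ with $\{0\}\neq I\cap J\subseteq P$, then $I\subseteq P$ or $J\subseteq P$. $M$ is $G$-graded weakly topological if $\Upsilon_M=\emptyset$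 or every graded pseudo weakly prime submodule of $M$ is graded weakly extraordinary. For a graded submodule $N$ of $M$, $\chi(N)=\{I\in\Upsilon_M: N\subseteq I\}$. The Zariski topology on $\Upsilon_M$ is the topology whose closed sets are exactly the sets $\chi(N)$, $N$ a graded submodule of $M$. For a subset $P\subseteq\Upsilon_M$, $\eta(P)$ is the intersection of all elements of $P$ (with $\eta(\emptyset)=M$). A nonempty subset $B$ of a topological space is irreducible if it is not the union of two proper subsets each closed in $B$; the empty set is not considered irreducible.
   Formalization: It is assumed that the sets χ(N) are the closed sets of a topology on Υ_M; being graded weakly topological does not ensure this (for trivial G and M = R = k×k, the set χ(k×0) ∪ χ(0×k) is not of the form χ(N)). *)

theory Defs
  imports
    "HOL-Algebra.Ideal"
    "HOL-Algebra.Module"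
    "HOL-Analysis.Abstract_Topology"
begin

section \<open>Gradings\<close>

text \<open>
  \<open>internal_direct_sum G M H A\<close> says that, in the additive group of \<open>M\<close> (a ring or a module),
  the additive subgroup \<open>H\<close> is the internal direct sum of the additive subgroups
  \<open>A g \<subseteq> H\<close>, \<open>g \<in> carrier G\<close>. The product \<open>Pi\<^sub>E\<close> makes the family \<open>f\<close> of components
  undefined outside \<open>carrier G\<close>, as needed for uniqueness.
\<close>

definition internal_direct_sum ::
    "('g, 'x) monoid_scheme \<Rightarrow> ('a, 'm) ring_scheme \<Rightarrow> 'a set \<Rightarrow> ('g \<Rightarrow> 'a set) \<Rightarrow> bool" where
  "internal_direct_sum G M H A \<longleftrightarrow>
     additive_subgroup H M \<and>
     (\<forall>g\<in>carrier G. additive_subgroup (A g) M \<and> A g \<subseteq> H) \<and>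
     (\<forall>x\<in>H. \<exists>!f. f \<in> (\<Pi>\<^sub>E g\<in>carrier G. A g) \<and>
        finite {g \<in> carrier G. f g \<noteq> \<zero>\<^bsub>M\<^esub>} \<and>
        x = (\<Oplus>\<^bsub>M\<^esub>g\<in>{g \<in> carrier G. f g \<noteq> \<zero>\<^bsub>M\<^esub>}. f g))"

definition graded_ring ::
    "('g, 'x) monoid_scheme \<Rightarrow> ('r, 'm) ring_scheme \<Rightarrow> ('g \<Rightarrow> 'r set) \<Rightarrow> bool" where
  "graded_ring G R \<R> \<longleftrightarrow>
     comm_group G \<and> cring R \<and>
     internal_direct_sum G R (carrier R) \<R> \<and>
     (\<forall>g\<in>carrier G. \<forall>h\<in>carrier G. \<forall>a\<in>\<R> g. \<forall>b\<in>\<R> h.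
        a \<otimes>\<^bsub>R\<^esub> b \<in> \<R> (g \<otimes>\<^bsub>G\<^esub> h))"

definition homogeneous_elements ::
    "('g, 'x) monoid_scheme \<Rightarrow> ('g \<Rightarrow> 'r set) \<Rightarrow> 'r set" where
  "homogeneous_elements G \<R> = (\<Union>g\<in>carrier G. \<R> g)"

definition graded_module ::
    "('g, 'x) monoid_scheme \<Rightarrow> ('r, 'm) ring_scheme \<Rightarrow> ('g \<Rightarrow> 'r set) \<Rightarrow>
     ('r, 'a, 'n) module_scheme \<Rightarrow> ('g \<Rightarrow> 'a set) \<Rightarrow> bool" where
  "graded_module G R \<R> M \<M> \<longleftrightarrow>
     graded_ring G R \<R> \<and> Module.module R M \<and>
     internal_direct_sum G M (carrier M) \<M> \<and>
     (\<forall>g\<in>carrier G. \<forall>h\<in>carrier G. \<forall>a\<in>\<R> g. \<forall>x\<in>\<M> h.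
        a \<odot>\<^bsub>M\<^esub> x \<in> \<M> (g \<otimes>\<^bsub>G\<^esub> h))"

definition graded_ideal ::
    "('g, 'x) monoid_scheme \<Rightarrow> ('r, 'm) ring_scheme \<Rightarrow> ('g \<Rightarrow> 'r set) \<Rightarrow> 'r set \<Rightarrow> bool" where
  "graded_ideal G R \<R> I \<longleftrightarrow>
     ideal I R \<and> internal_direct_sum G R I (\<lambda>g. I \<inter> \<R> g)"

definition graded_submodule ::
    "('g, 'x) monoid_scheme \<Rightarrow> ('r, 'm) ring_scheme \<Rightarrow>
     ('r, 'a, 'n) module_scheme \<Rightarrow> ('g \<Rightarrow> 'a set) \<Rightarrow> 'a set \<Rightarrow> bool" where
  "graded_submodule G R M \<M> P \<longleftrightarrow>
     submodule P R M \<and> internal_direct_sum G M P (\<lambda>g. P \<inter> \<M> g)"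


section \<open>Weakly prime ideals and pseudo weakly prime submodules\<close>

definition colon_ideal ::
    "('r, 'm) ring_scheme \<Rightarrow> ('r, 'a, 'n) module_scheme \<Rightarrow> 'a set \<Rightarrow> 'r set" where
  "colon_ideal R M P = {r \<in> carrier R. \<forall>x\<in>carrier M. r \<odot>\<^bsub>M\<^esub> x \<in> P}"

definition graded_weakly_prime_ideal ::
    "('g, 'x) monoid_scheme \<Rightarrow> ('r, 'm) ring_scheme \<Rightarrow> ('g \<Rightarrow> 'r set) \<Rightarrow> 'r set \<Rightarrow> bool" where
  "graded_weakly_prime_ideal G R \<R> I \<longleftrightarrow>
     graded_ideal G R \<R> I \<and> I \<noteq> carrier R \<and>
     (\<forall>a\<in>homogeneous_elements G \<R>. \<forall>b\<in>homogeneous_elements G \<R>.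
        a \<otimes>\<^bsub>R\<^esub> b \<noteq> \<zero>\<^bsub>R\<^esub> \<and> a \<otimes>\<^bsub>R\<^esub> b \<in> I \<longrightarrow> a \<in> I \<or> b \<in> I)"

definition graded_pseudo_weakly_prime ::
    "('g, 'x) monoid_scheme \<Rightarrow> ('r, 'm) ring_scheme \<Rightarrow> ('g \<Rightarrow> 'r set) \<Rightarrow>
     ('r, 'a, 'n) module_scheme \<Rightarrow> ('g \<Rightarrow> 'a set) \<Rightarrow> 'a set \<Rightarrow> bool" where
  "graded_pseudo_weakly_prime G R \<R> M \<M> P \<longleftrightarrow>
     graded_submodule G R M \<M> P \<and> graded_weakly_prime_ideal G R \<R> (colon_ideal R M P)"

definition pseudo_weakly_prime_spectrum ::
    "('g, 'x) monoid_scheme \<Rightarrow> ('r, 'm) ring_scheme \<Rightarrow> ('g \<Rightarrow> 'r set) \<Rightarrow>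
     ('r, 'a, 'n) module_scheme \<Rightarrow> ('g \<Rightarrow> 'a set) \<Rightarrow> 'a set set" where
  "pseudo_weakly_prime_spectrum G R \<R> M \<M> = {P. graded_pseudo_weakly_prime G R \<R> M \<M> P}"

text \<open>Intersecting with \<open>carrier M\<close> only matters for the empty family, whose intersection is \<open>M\<close>.\<close>

definition submodule_Inter :: "('r, 'a, 'n) module_scheme \<Rightarrow> 'a set set \<Rightarrow> 'a set" where
  "submodule_Inter M \<P> = carrier M \<inter> \<Inter>\<P>"

text \<open>
  The empty family is allowed here, so \<open>M\<close> itself counts as semiprime. This does not affect
  \<open>graded_weakly_extraordinary\<close>: for \<open>I = M\<close> the condition \<open>I \<inter> J \<subseteq> P\<close> already says
  \<open>J \<subseteq> P\<close>.
\<close>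

definition graded_pseudo_weakly_semiprime ::
    "('g, 'x) monoid_scheme \<Rightarrow> ('r, 'm) ring_scheme \<Rightarrow> ('g \<Rightarrow> 'r set) \<Rightarrow>
     ('r, 'a, 'n) module_scheme \<Rightarrow> ('g \<Rightarrow> 'a set) \<Rightarrow> 'a set \<Rightarrow> bool" where
  "graded_pseudo_weakly_semiprime G R \<R> M \<M> N \<longleftrightarrow>
     graded_submodule G R M \<M> N \<and>
     (\<exists>\<P> \<subseteq> pseudo_weakly_prime_spectrum G R \<R> M \<M>. N = submodule_Inter M \<P>)"

definition graded_weakly_extraordinary ::
    "('g, 'x) monoid_scheme \<Rightarrow> ('r, 'm) ring_scheme \<Rightarrow> ('g \<Rightarrow> 'r set) \<Rightarrow>
     ('r, 'a, 'n) module_scheme \<Rightarrow> ('g \<Rightarrow> 'a set) \<Rightarrow> 'a set \<Rightarrow> bool" where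
  "graded_weakly_extraordinary G R \<R> M \<M> P \<longleftrightarrow>
     graded_pseudo_weakly_prime G R \<R> M \<M> P \<and>
     (\<forall>I J. graded_pseudo_weakly_semiprime G R \<R> M \<M> I \<and>
            graded_pseudo_weakly_semiprime G R \<R> M \<M> J \<and>
            {\<zero>\<^bsub>M\<^esub>} \<noteq> I \<inter> J \<and> I \<inter> J \<subseteq> P \<longrightarrow> I \<subseteq> P \<or> J \<subseteq> P)"

definition graded_weakly_topological ::
    "('g, 'x) monoid_scheme \<Rightarrow> ('r, 'm) ring_scheme \<Rightarrow> ('g \<Rightarrow> 'r set) \<Rightarrow>
     ('r, 'a, 'n) module_scheme \<Rightarrow> ('g \<Rightarrow> 'a set) \<Rightarrow> bool" where
  "graded_weakly_topological G R \<R> M \<M> \<longleftrightarrow>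
     graded_module G R \<R> M \<M> \<and>
     (pseudo_weakly_prime_spectrum G R \<R> M \<M> = {} \<or>
      (\<forall>P. graded_pseudo_weakly_prime G R \<R> M \<M> P \<longrightarrow>
           graded_weakly_extraordinary G R \<R> M \<M> P))"


section \<open>The Zariski topology\<close>

definition zariski_closed_set ::
    "('g, 'x) monoid_scheme \<Rightarrow> ('r, 'm) ring_scheme \<Rightarrow> ('g \<Rightarrow> 'r set) \<Rightarrow>
     ('r, 'a, 'n) module_scheme \<Rightarrow> ('g \<Rightarrow> 'a set) \<Rightarrow> 'a set \<Rightarrow> 'a set set" where
  "zariski_closed_set G R \<R> M \<M> N = {I \<in> pseudo_weakly_prime_spectrum G R \<R> M \<M>. N \<subseteq> I}"

text \<open>
  \<open>is_zariski_topology G R \<R> M \<M> X\<close> characterizes the Zariski topology \<open>X\<close> uniquely (a topology is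
  determined by its closed sets), but does not claim that it exists. Indeed, the sets
  \<open>zariski_closed_set G R \<R> M \<M> N\<close> need not be closed under binary unions, even over a
  graded weakly topological module: take \<open>G\<close> trivial and \<open>M = R = k \<times> k\<close> for a field \<open>k\<close>.
\<close>

definition is_zariski_topology ::
    "('g, 'x) monoid_scheme \<Rightarrow> ('r, 'm) ring_scheme \<Rightarrow> ('g \<Rightarrow> 'r set) \<Rightarrow>
     ('r, 'a, 'n) module_scheme \<Rightarrow> ('g \<Rightarrow> 'a set) \<Rightarrow> 'a set topology \<Rightarrow> bool" where
  "is_zariski_topology G R \<R> M \<M> X \<longleftrightarrow>
     topspace X = pseudo_weakly_prime_spectrum G R \<R> M \<M> \<and>
     (\<forall>C. closedin X C \<longleftrightarrow>
        (\<exists>N. graded_submodule G R M \<M> N \<and> C = zariski_closed_set G R \<R> M \<M> N))"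

definition irreducible_space :: "'a topology \<Rightarrow> bool" where
  "irreducible_space X \<longleftrightarrow>
     topspace X \<noteq> {} \<and>
     \<not> (\<exists>A B. closedin X A \<and> closedin X B \<and> A \<subset> topspace X \<and> B \<subset> topspace X \<and>
              topspace X = A \<union> B)"

end

theory Submission
  imports Defs
begin

text \<open>
  Write \<open>\<eta>(P)\<close> for \<open>submodule_Inter M P\<close> and \<open>\<chi>(N)\<close> for \<open>zariski_closed_set G R \<R> M \<M> N\<close>.
  If \<open>\<eta>(P)\<close> is pseudo weakly prime, then it is a point of the spectrum that behaves like a generic
  point of \<open>P\<close>. A cover of \<open>P\<close> by two closed sets \<open>\<chi>(N\<^sub>1)\<close>, \<open>\<chi>(N\<^sub>2)\<close> has a closed union \<open>\<chi>(N\<^sub>3)\<close>;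
  from \<open>P \<subseteq> \<chi>(N\<^sub>3)\<close> follows \<open>N\<^sub>3 \<subseteq> \<eta>(P)\<close>, so that \<open>\<eta>(P)\<close> itself lies in \<open>\<chi>(N\<^sub>1)\<close>
  or \<open>\<chi>(N\<^sub>2)\<close>, and this closed set contains all of \<open>P\<close>.

  Conversely, let \<open>P\<close> be irreducible and let \<open>0 \<noteq> ab \<in> (\<eta>(P) : M)\<close> with \<open>a\<close>, \<open>b\<close> homogeneous. Every
  \<open>Q \<in> P\<close> has \<open>a\<close> or \<open>b\<close> in its colon ideal, so \<open>P\<close> is the union of the two sets
  \<open>{Q \<in> P. r \<in> (Q : M)}\<close>, \<open>r = a, b\<close>. Each is closed in \<open>P\<close>, being cut out by its own
  intersection (\<open>closedin_colon_ideal\<close>), so one of them is \<open>P\<close>. That \<open>\<eta>(P)\<close> and its colon ideal are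
  graded holds because homogeneous components are unique and hence common to all members of a
  family (\<open>internal_direct_sum_Inter\<close>).
\<close>

lemma additive_subgroup_carrier_Inter:
  assumes "abelian_group M" and "\<And>H. H \<in> \<F> \<Longrightarrow> additive_subgroup H M"
  shows "additive_subgroup (carrier M \<inter> \<Inter>\<F>) M"
proof -
  interpret abelian_group M by fact
  have "subgroup (\<Inter>(insert (carrier M) \<F>)) (add_monoid M)"
    using assms(2) add.subgroup_self
    by (intro add.subgroups_Inter) (auto simp: additive_subgroup_def)
  then show ?thesis by (simp add: additive_subgroup_def)
qed

text \<open>
  The components of \<open>x\<close> with respect to a member \<open>H\<close> of the family are also components with respect
  to \<open>carrier M\<close>, so by uniqueness they do not depend on \<open>H\<close> and lie in every member.
\<close>

lemma internal_direct_sum_Inter: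
  assumes M: "abelian_group M"
    and sum: "internal_direct_sum G M (carrier M) A"
    and \<F>: "\<And>H. H \<in> \<F> \<Longrightarrow> internal_direct_sum G M H (\<lambda>g. H \<inter> A g)"
  shows "internal_direct_sum G M (carrier M \<inter> \<Inter>\<F>) (\<lambda>g. (carrier M \<inter> \<Inter>\<F>) \<inter> A g)"
proof -
  let ?N = "carrier M \<inter> \<Inter>\<F>"
  let ?dec = "\<lambda>B x f. f \<in> (\<Pi>\<^sub>E g\<in>carrier G. B g) \<and> finite {g \<in> carrier G. f g \<noteq> \<zero>\<^bsub>M\<^esub>} \<and>
        x = (\<Oplus>\<^bsub>M\<^esub>g\<in>{g \<in> carrier G. f g \<noteq> \<zero>\<^bsub>M\<^esub>}. f g)"
  have sub: "additive_subgroup H M" if "H \<in> \<F>" for H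
    using \<F>[OF that] by (simp add: internal_direct_sum_def)
  have "additive_subgroup (?N \<inter> A g) M" if "g \<in> carrier G" for g
  proof -
    have "additive_subgroup (carrier M \<inter> \<Inter>(insert (A g) \<F>)) M"
      using sum that sub
      by (intro additive_subgroup_carrier_Inter[OF M]) (auto simp: internal_direct_sum_def)
    then show ?thesis by (simp add: Int_ac)
  qed
  moreover have "\<exists>!f. ?dec (\<lambda>g. ?N \<inter> A g) x f" if x: "x \<in> ?N" for x
  proof -
    have ex1: "\<exists>!f. ?dec A x f"
      using sum x by (simp add: internal_direct_sum_def)
    then obtain f where f: "?dec A x f" by blast
    have "f \<in> (\<Pi>\<^sub>E g\<in>carrier G. H \<inter> A g)" if "H \<in> \<F>" for H
    proof -
      have "\<exists>!f. ?dec (\<lambda>g. H \<inter> A g) x f"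
        using \<F>[OF that] x that by (simp add: internal_direct_sum_def)
      then obtain f' where f': "?dec (\<lambda>g. H \<inter> A g) x f'" by blast
      then have "?dec A x f'" by (auto simp: PiE_iff)
      with ex1 f have "f' = f" by blast
      with f' show ?thesis by blast
    qed
    moreover have "A g \<subseteq> carrier M" if "g \<in> carrier G" for g
      using sum that by (simp add: internal_direct_sum_def)
    ultimately have "f \<in> (\<Pi>\<^sub>E g\<in>carrier G. ?N \<inter> A g)"
      using f by (auto simp: PiE_iff)
    with f have "?dec (\<lambda>g. ?N \<inter> A g) x f" by blast
    moreover have "f' = f" if "?dec (\<lambda>g. ?N \<inter> A g) x f'" for f'
    proof -
      from that have "?dec A x f'" by (auto simp: PiE_iff)
      with ex1 f show ?thesis by blast
    qed
    ultimately show ?thesis by (rule ex1I)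
  qed
  ultimately show ?thesis
    unfolding internal_direct_sum_def
    using additive_subgroup_carrier_Inter[of M \<F>, OF M sub] by blast
qed

lemma submodule_submodule_Inter:
  assumes "Module.module R M" and "\<And>Q. Q \<in> \<P> \<Longrightarrow> submodule Q R M"
  shows "submodule (submodule_Inter M \<P>) R M"
proof -
  interpret Module.module R M by fact
  have "additive_subgroup (carrier M \<inter> \<Inter>\<P>) M"
    using assms(2) by (intro additive_subgroup_carrier_Inter abelian_group_axioms)
      (auto simp: submodule_def additive_subgroup_def)
  moreover have "r \<odot>\<^bsub>M\<^esub> x \<in> carrier M \<inter> \<Inter>\<P>"
    if "r \<in> carrier R" "x \<in> carrier M \<inter> \<Inter>\<P>" for r x
    using that assms(2) by (auto intro: submodule.smult_closed)
  ultimately show ?thesis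
    by (simp add: submodule_Inter_def submodule_def submodule_axioms_def additive_subgroup_def)
qed

lemma graded_submodule_submodule_Inter:
  assumes M: "graded_module G R \<R> M \<M>"
    and \<P>: "\<And>Q. Q \<in> \<P> \<Longrightarrow> graded_submodule G R M \<M> Q"
  shows "graded_submodule G R M \<M> (submodule_Inter M \<P>)"
proof -
  have "Module.module R M" using M by (simp add: graded_module_def)
  then have "abelian_group M" by (rule module.axioms)
  then have "internal_direct_sum G M (submodule_Inter M \<P>) (\<lambda>g. submodule_Inter M \<P> \<inter> \<M> g)"
    unfolding submodule_Inter_def using M \<P>
    by (intro internal_direct_sum_Inter) (simp_all add: graded_module_def graded_submodule_def)
  moreover have "submodule (submodule_Inter M \<P>) R M"
    using \<open>Module.module R M\<close> \<P> by (simp add: submodule_submodule_Inter graded_submodule_def)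
  ultimately show ?thesis by (simp add: graded_submodule_def)
qed

lemma graded_ideal_Inter:
  assumes R: "graded_ring G R \<R>" and "\<I> \<noteq> {}"
    and \<I>: "\<And>I. I \<in> \<I> \<Longrightarrow> graded_ideal G R \<R> I"
  shows "graded_ideal G R \<R> (\<Inter>\<I>)"
proof -
  interpret cring R using R by (simp add: graded_ring_def)
  have ideal: "ideal (\<Inter>\<I>) R"
    using assms by (intro i_Intersect) (auto simp: graded_ideal_def)
  then have "carrier R \<inter> \<Inter>\<I> = \<Inter>\<I>"
    by (auto dest: ideal.Icarr)
  moreover have "internal_direct_sum G R (carrier R \<inter> \<Inter>\<I>) (\<lambda>g. (carrier R \<inter> \<Inter>\<I>) \<inter> \<R> g)"
    using R \<I> by (intro internal_direct_sum_Inter abelian_group_axioms)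
      (simp_all add: graded_ring_def graded_ideal_def)
  ultimately show ?thesis using ideal by (simp add: graded_ideal_def)
qed

lemma colon_ideal_carrier:
  assumes "Module.module R M"
  shows "colon_ideal R M (carrier M) = carrier R"
  using assms by (auto simp: colon_ideal_def intro: module.smult_closed)

lemma colon_ideal_submodule_Inter:
  assumes "Module.module R M" and "\<P> \<noteq> {}"
  shows "colon_ideal R M (submodule_Inter M \<P>) = (\<Inter>Q\<in>\<P>. colon_ideal R M Q)"
  using assms by (auto simp: colon_ideal_def submodule_Inter_def intro: module.smult_closed)

text \<open>
  With \<open>A = {Q \<in> P. r \<in> (Q : M)}\<close>, the set \<open>A\<close> equals \<open>\<chi>(\<eta>(A)) \<inter> P\<close>: all multiples \<open>r x\<close> lie in \<open>\<eta>(A)\<close>, hence in every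
  \<open>Q\<close> that contains \<open>\<eta>(A)\<close>. Using \<open>\<eta>(A)\<close> instead of \<open>rM\<close> makes homogeneity of \<open>r\<close> unnecessary.
\<close>

lemma closedin_colon_ideal:
  assumes M: "graded_module G R \<R> M \<M>"
    and X: "is_zariski_topology G R \<R> M \<M> X"
    and P: "P \<subseteq> pseudo_weakly_prime_spectrum G R \<R> M \<M>"
    and r: "r \<in> carrier R"
  shows "closedin (subtopology X P) {Q \<in> P. r \<in> colon_ideal R M Q}"
proof -
  let ?A = "{Q \<in> P. r \<in> colon_ideal R M Q}"
  have "graded_submodule G R M \<M> (submodule_Inter M ?A)"
    using P by (intro graded_submodule_submodule_Inter[OF M])
      (auto simp: pseudo_weakly_prime_spectrum_def graded_pseudo_weakly_prime_def)
  then have "closedin X (zariski_closed_set G R \<R> M \<M> (submodule_Inter M ?A))"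
    using X by (auto simp: is_zariski_topology_def)
  moreover have "?A = zariski_closed_set G R \<R> M \<M> (submodule_Inter M ?A) \<inter> P"
  proof (intro equalityI subsetI)
    fix Q assume "Q \<in> zariski_closed_set G R \<R> M \<M> (submodule_Inter M ?A) \<inter> P"
    then have "submodule_Inter M ?A \<subseteq> Q" "Q \<in> P"
      by (auto simp: zariski_closed_set_def)
    moreover have "r \<odot>\<^bsub>M\<^esub> x \<in> submodule_Inter M ?A" if "x \<in> carrier M" for x
      using that r M
      by (auto simp: submodule_Inter_def colon_ideal_def graded_module_def
          intro: module.smult_closed)
    ultimately show "Q \<in> ?A"
      using r by (auto simp: colon_ideal_def)
  qed (use P in \<open>auto simp: zariski_closed_set_def submodule_Inter_def\<close>)
  ultimately show ?thesis
    unfolding closedin_subtopology by blast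
qed

lemma irreducible_space_if_graded_pseudo_weakly_prime:
  assumes M: "graded_module G R \<R> M \<M>"
    and X: "is_zariski_topology G R \<R> M \<M> X"
    and P: "P \<subseteq> pseudo_weakly_prime_spectrum G R \<R> M \<M>"
    and prime: "graded_pseudo_weakly_prime G R \<R> M \<M> (submodule_Inter M P)"
  shows "irreducible_space (subtopology X P)"
proof -
  let ?\<eta> = "submodule_Inter M P"
  let ?\<chi> = "zariski_closed_set G R \<R> M \<M>"
  have top: "topspace (subtopology X P) = P"
    using X P by (auto simp: is_zariski_topology_def)
  have "P \<noteq> {}"
  proof
    assume "P = {}"
    \<comment> \<open>The intersection of the empty family is \<open>M\<close>, whose colon ideal is not proper.\<close>
    then have "colon_ideal R M ?\<eta> = carrier R"
      using M by (simp add: submodule_Inter_def colon_ideal_carrier graded_module_def)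
    with prime show False
      by (simp add: graded_pseudo_weakly_prime_def graded_weakly_prime_ideal_def)
  qed
  moreover have "A = P \<or> B = P"
    if "closedin (subtopology X P) A" "closedin (subtopology X P) B" "P = A \<union> B" for A B
  proof -
    from that obtain C D where CD: "closedin X C" "closedin X D" "A = C \<inter> P" "B = D \<inter> P"
      unfolding closedin_subtopology by blast
    then obtain N1 N2 where N: "C = ?\<chi> N1" "D = ?\<chi> N2"
      using X by (auto simp: is_zariski_topology_def)
    from CD have "closedin X (C \<union> D)" by blast
    then obtain N3 where N3: "graded_submodule G R M \<M> N3" "C \<union> D = ?\<chi> N3"
      using X by (auto simp: is_zariski_topology_def)
    have "N3 \<subseteq> carrier M"
      using N3(1) M module.submoduleE(1)
      unfolding graded_submodule_def graded_module_def by blast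
    moreover have "N3 \<subseteq> Q" if "Q \<in> P" for Q
    proof -
      have "Q \<in> C \<union> D" using that \<open>P = A \<union> B\<close> CD by blast
      then show ?thesis unfolding N3(2) by (simp add: zariski_closed_set_def)
    qed
    ultimately have "N3 \<subseteq> ?\<eta>" by (auto simp: submodule_Inter_def)
    \<comment> \<open>Here \<open>\<eta>(P)\<close> is used as a point of the spectrum.\<close>
    then have "?\<eta> \<in> C \<union> D"
      using prime by (simp add: N3(2) zariski_closed_set_def pseudo_weakly_prime_spectrum_def)
    then have "N1 \<subseteq> ?\<eta> \<or> N2 \<subseteq> ?\<eta>"
      by (auto simp: N zariski_closed_set_def)
    then have "P \<subseteq> C \<or> P \<subseteq> D"
      using P by (auto simp: N zariski_closed_set_def submodule_Inter_def)
    then show ?thesis using CD by blast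
  qed
  ultimately show ?thesis
    unfolding irreducible_space_def top by blast
qed

lemma graded_pseudo_weakly_prime_if_irreducible_space:
  assumes M: "graded_module G R \<R> M \<M>"
    and X: "is_zariski_topology G R \<R> M \<M> X"
    and P: "P \<subseteq> pseudo_weakly_prime_spectrum G R \<R> M \<M>"
    and irr: "irreducible_space (subtopology X P)"
  shows "graded_pseudo_weakly_prime G R \<R> M \<M> (submodule_Inter M P)"
proof -
  let ?\<eta> = "submodule_Inter M P"
  have R: "graded_ring G R \<R>" and mod: "Module.module R M"
    using M by (simp_all add: graded_module_def)
  have top: "topspace (subtopology X P) = P"
    using X P by (auto simp: is_zariski_topology_def)
  then have "P \<noteq> {}" using irr by (simp add: irreducible_space_def)
  note colon = colon_ideal_submodule_Inter[OF mod this]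
  have sub: "graded_submodule G R M \<M> Q"
    and wprime: "graded_weakly_prime_ideal G R \<R> (colon_ideal R M Q)" if "Q \<in> P" for Q
    using that P by (auto simp: pseudo_weakly_prime_spectrum_def graded_pseudo_weakly_prime_def)
  have "graded_submodule G R M \<M> ?\<eta>"
    using sub by (rule graded_submodule_submodule_Inter[OF M])
  moreover have "graded_ideal G R \<R> (colon_ideal R M ?\<eta>)"
    unfolding colon using \<open>P \<noteq> {}\<close> wprime
    by (intro graded_ideal_Inter[OF R]) (auto simp: graded_weakly_prime_ideal_def)
  moreover have "colon_ideal R M ?\<eta> \<noteq> carrier R"
  proof -
    obtain Q where "Q \<in> P" using \<open>P \<noteq> {}\<close> by blast
    then have "colon_ideal R M ?\<eta> \<subseteq> colon_ideal R M Q" unfolding colon by blast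
    moreover have "colon_ideal R M Q \<subset> carrier R"
      using wprime[OF \<open>Q \<in> P\<close>] by (auto simp: graded_weakly_prime_ideal_def colon_ideal_def)
    ultimately show ?thesis by blast
  qed
  moreover have "a \<in> colon_ideal R M ?\<eta> \<or> b \<in> colon_ideal R M ?\<eta>"
    if ab: "a \<in> homogeneous_elements G \<R>" "b \<in> homogeneous_elements G \<R>"
      and nz: "a \<otimes>\<^bsub>R\<^esub> b \<noteq> \<zero>\<^bsub>R\<^esub>" and mem: "a \<otimes>\<^bsub>R\<^esub> b \<in> colon_ideal R M ?\<eta>" for a b
  proof -
    let ?V = "\<lambda>r. {Q \<in> P. r \<in> colon_ideal R M Q}"
    have "a \<in> carrier R" "b \<in> carrier R"
      using ab R by (auto simp: homogeneous_elements_def graded_ring_def internal_direct_sum_def)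
    then have "closedin (subtopology X P) (?V a)" "closedin (subtopology X P) (?V b)"
      using closedin_colon_ideal[OF M X P] by blast+
    moreover have "P = ?V a \<union> ?V b"
      using wprime ab nz mem unfolding colon graded_weakly_prime_ideal_def by blast
    ultimately have "?V a = P \<or> ?V b = P"
      using irr unfolding irreducible_space_def top by blast
    then show ?thesis unfolding colon by blast
  qed
  ultimately show ?thesis
    by (simp add: graded_pseudo_weakly_prime_def graded_weakly_prime_ideal_def)
qed

theorem theorem3p7:
  fixes G :: "('g, 'x) monoid_scheme"
    and R :: "('r, 'm) ring_scheme" and \<R> :: "'g \<Rightarrow> 'r set"
    and M :: "('r, 'a, 'n) module_scheme" and \<M> :: "'g \<Rightarrow> 'a set"
    and X :: "'a set topology" and P :: "'a set set"
  assumes "comm_group G"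
    and "graded_ring G R \<R>"
    and "graded_module G R \<R> M \<M>"
    and "graded_weakly_topological G R \<R> M \<M>"
    and "is_zariski_topology G R \<R> M \<M> X"
    and "P \<subseteq> pseudo_weakly_prime_spectrum G R \<R> M \<M>"
  shows "graded_pseudo_weakly_prime G R \<R> M \<M> (submodule_Inter M P)
     \<longleftrightarrow> irreducible_space (subtopology X P)"
  using irreducible_space_if_graded_pseudo_weakly_prime[OF assms(3,5,6)]
    graded_pseudo_weakly_prime_if_irreducible_space[OF assms(3,5,6)]
  by blast

end
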